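(* Let $\kappa\in\{\operatorname{cf}(\mathfrak d),\mathfrak d\}$, and let $X\subseteq[\mathbb N]^{\infty}$ be a set containing a $\kappa$-unbounded set. Then there is a $\mathfrak d$-concentrated real set $Y$ such that the product space $X\times Y$ is not Menger.
   Context: $\mathbb N=\{1,2,\dots\}$. The family $P(\mathbb N)$ of all subsets of $\mathbb N$ is identified with the Cantor space $\{0,1\}^{\mathbb N}$, with its topology; $[\mathbb N]^{\infty}$ is the subspace of infinite subsets of $\mathbb N$. Each $a\in[\mathbb N]^\infty$ is identified with its increasing enumeration: $a(n)$ is the $n$-th element of $a$. A real set is a set of real numbers with the subspace topology; subspaces of $P(\mathbb N)$ are regarded as real sets (via the homeomorphism of $P(\mathbb N)$ with Cantor's set). For $a,b\in[\mathbb N]^\infty$: $a\le b$ means $a(n)\le b(n)$ for all $n$; $a\le^* b$ means $a(n)\le b(n)$ for all but finitely many $n$. A set $A\subseteq[\mathbb N]^\infty$ is $\le$-bounded if there is $b\in[\mathbb N]^\infty$ with $a\le b$ for all $a\in A$. A set $D\subseteq[\mathbb N]^\infty$ is dominating if for each $a\in[\mathbb N]^\infty$ there is $d\in D$ with $a\le^* d$; $\mathfrak d$ is the minimal cardinality of a dominating set, and $\operatorname{cf}(\mathfrak d)$ is its cofinality. For an infinite cardinal $\kappa$, a set $A\subseteq[\mathbb N]^\infty$ with $|A|\ge\kappa$ is $\kappa$-unbounded if every $\le$-bounded subset of $A$ has cardinality smaller than $\kappa$. A topological space $X$ with $|X|\ge\kappa$ is $\kappa$-concentrated if there is a countable set $D\subseteq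 X$ such that $|X\setminus U|<\kappa$ for all open sets $U\supseteq D$. A topological space $X$ is Menger if for each sequence $\mathcal U_1,\mathcal U_2,\dots$ of open covers of $X$ there are finite sets $\mathcal F_1\subseteq\mathcal U_1,\mathcal F_2\subseteq\mathcal U_2,\dots$ whose union covers $X$. *)

theory Defs
  imports "HOL-Analysis.Analysis"
begin

unbundle cardinal_syntax

section \<open>Cardinals\<close>

text \<open>Cardinals are represented, as in the library, by cardinal orders (relations), compared
  by \<open>\<le>o\<close> and \<open><o\<close>.\<close>

definition min_card :: "'a set set \<Rightarrow> 'a rel" where
  "min_card \<A> = (SOME r. r \<in> card_of ` \<A> \<and> (\<forall>A\<in>\<A>. r \<le>o |A| ))"

lemma min_card:
  assumes "\<A> \<noteq> {}"
  shows "min_card \<A> \<in> card_of ` \<A>" and "\<And>A. A \<in> \<A> \<Longrightarrow> min_card \<A> \<le>o |A|"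
proof -
  have "\<exists>r. r \<in> card_of ` \<A> \<and> (\<forall>A\<in>\<A>. r \<le>o |A| )"
    using exists_minim_Card_order[of "card_of ` \<A>"] assms card_of_Card_order by auto
  from someI_ex[OF this] show "min_card \<A> \<in> card_of ` \<A>" "\<And>A. A \<in> \<A> \<Longrightarrow> min_card \<A> \<le>o |A|"
    unfolding min_card_def by auto
qed

text \<open>The library notion \<^const>\<open>cofinal\<close> is strict (every element lies strictly below some element
  of the cofinal set); on orders without a greatest element, such as infinite cardinals, this is
  the usual notion.\<close>

definition cofinality :: "'a rel \<Rightarrow> 'a rel" where
  "cofinality r = min_card {A. A \<subseteq> Field r \<and> cofinal A r}"


section \<open>Infinite sets of positive integers\<close>

definition inf_subsets :: "nat set set" where
  "inf_subsets = {a. a \<subseteq> {1..} \<and> infinite a}"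

text \<open>The \<open>n\<close>-th element of \<open>a\<close> (\<open>n = 1, 2, \<dots>\<close>) is \<open>enumerate a (n - 1)\<close>. Since the relations
  below compare equal positions only, we let the index start at \<open>0\<close>.\<close>

definition enum_le :: "nat set \<Rightarrow> nat set \<Rightarrow> bool" where
  "enum_le a b \<longleftrightarrow> (\<forall>n. enumerate a n \<le> enumerate b n)"

definition enum_le_star :: "nat set \<Rightarrow> nat set \<Rightarrow> bool" where
  "enum_le_star a b \<longleftrightarrow> finite {n. \<not> enumerate a n \<le> enumerate b n}"

definition le_bounded :: "nat set set \<Rightarrow> bool" where
  "le_bounded A \<longleftrightarrow> (\<exists>b\<in>inf_subsets. \<forall>a\<in>A. enum_le a b)"

definition dominating :: "nat set set \<Rightarrow> bool" where
  "dominating D \<longleftrightarrow> D \<subseteq> inf_subsets \<and> (\<forall>a\<in>inf_subsets. \<exists>d\<in>D. enum_le_star a d)"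

definition dominating_number :: "nat set rel" where
  "dominating_number = min_card {D. dominating D}"

definition unbounded_card :: "'k rel \<Rightarrow> nat set set \<Rightarrow> bool" where
  "unbounded_card \<kappa> A \<longleftrightarrow>
     A \<subseteq> inf_subsets \<and> \<kappa> \<le>o |A| \<and> (\<forall>B. B \<subseteq> A \<and> le_bounded B \<longrightarrow> |B| <o \<kappa>)"


section \<open>Topological notions\<close>

text \<open>\<open>P(\<nat>)\<close> carries the topology of the Cantor space \<open>{0,1}\<^sup>\<nat>\<close>, transported along
  characteristic functions.\<close>

definition cantor_topology :: "nat set topology" where
  "cantor_topology =
     pullback_topology (Pow {1..}) (\<lambda>a. \<lambda>n\<in>{1..}. n \<in> a)
       (product_topology (\<lambda>_. discrete_topology (UNIV :: bool set)) {1..})"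

definition concentrated :: "'k rel \<Rightarrow> 'a topology \<Rightarrow> bool" where
  "concentrated \<kappa> T \<longleftrightarrow>
     \<kappa> \<le>o |topspace T| \<and>
     (\<exists>D. countable D \<and> D \<subseteq> topspace T \<and>
        (\<forall>U. openin T U \<and> D \<subseteq> U \<longrightarrow> |topspace T - U| <o \<kappa>))"

definition open_cover :: "'a topology \<Rightarrow> 'a set set \<Rightarrow> bool" where
  "open_cover T \<U> \<longleftrightarrow> (\<forall>U\<in>\<U>. openin T U) \<and> \<Union>\<U> = topspace T"

definition menger_space :: "'a topology \<Rightarrow> bool" where
  "menger_space T \<longleftrightarrow>
     (\<forall>\<U> :: nat \<Rightarrow> 'a set set. (\<forall>n. open_cover T (\<U> n)) \<longrightarrow>
        (\<exists>\<F>. (\<forall>n. finite (\<F> n) \<and> \<F> n \<subseteq> \<U> n) \<and> \<Union>(\<Union>n. \<F> n) = topspace T))"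

end

theory Submission
  imports Defs
begin

text \<open>
  Let \<open>D\<close> be a dominating set of size \<open>\<dd>\<close>. Both choices of \<open>\<kappa>\<close> allow us to attach to each
  \<open>d \<in> D\<close> a set \<open>x d \<in> X\<close> so that every \<open>\<le>\<close>-bounded set contains \<open>x d\<close> for fewer than \<open>\<dd>\<close>
  many \<open>d\<close>: for \<open>\<kappa> = \<dd>\<close> take an injection, and for \<open>\<kappa> = cf(\<dd>)\<close> send \<open>d\<close> first to a later element of
  a cofinal subset of \<open>D\<close> of size \<open>\<kappa>\<close>, and inject that subset. Choose \<open>e d \<subseteq> x d\<close> lying above
  \<open>d\<close>, so that the sets \<open>e d\<close> are still dominating, and let \<open>Y\<close> consist of codes for the pairs
  \<open>(x d, e d)\<close> and for all finite sets. Each gap of \<open>x d\<close> is also a gap of \<open>e d\<close>, and the codes outside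
  a neighbourhood of the finite sets have gaps bounded by a fixed function; hence \<open>Y\<close> is
  concentrated on the finite sets. Finally \<open>(x, (u, v)) \<mapsto> (x \<triangle> u) \<union> v\<close> is a continuous map on
  \<open>X \<times> Y\<close> whose values are always infinite (\<open>x\<close> is infinite, while \<open>u\<close> is finite or \<open>v\<close> is
  infinite), and it maps \<open>(x d, (x d, e d))\<close> to \<open>e d\<close>. So \<open>X \<times> Y\<close> has a dominating continuous image
  and is not Menger.
\<close>

section \<open>Enumerations of infinite sets\<close>

text \<open>Induction on \<open>n\<close>. Only the first \<open>n + 1\<close> values of
  \<open>g\<close> are constrained, so the bound applies to sets known only up to some
  point.\<close>

lemma enumerate_le_of_strict_mono_on:
  fixes g :: "nat \<Rightarrow> nat"
  assumes "infinite T" and "\<And>i j. i < j \<Longrightarrow> j \<le> n \<Longrightarrow> g i < g j"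
    and "\<And>i. i \<le> n \<Longrightarrow> g i \<in> T"
  shows "enumerate T n \<le> g n"
  using assms
proof (induction n)
  case 0
  then show ?case by (simp add: enumerate_0 Least_le)
next
  case (Suc n)
  have "enumerate T n \<le> g n" using Suc by simp
  also have "g n < g (Suc n)" using Suc.prems(2) by simp
  finally show ?case
    using Suc.prems(1,3) by (simp add: enumerate_Suc'' Least_le)
qed

text \<open>The enumeration is \<open>g\<close> composed with a strictly increasing index map
  \<open>j\<close>, and \<open>n \<le> j n\<close>; the other inequality is minimality of the
  enumeration.\<close>

lemma enumerate_range_strict_mono:
  fixes g :: "nat \<Rightarrow> nat"
  assumes "strict_mono g"
  shows "enumerate (range g) = g"
proof
  fix n
  have inf: "infinite (range g)"
    using assms strict_mono_imp_inj_on range_inj_infinite by blast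
  have "enumerate (range g) k \<in> range g" for k
    using inf enumerate_in_set by blast
  then have "\<forall>k. \<exists>i. enumerate (range g) k = g i" by blast
  then obtain j where j: "\<And>k. enumerate (range g) k = g (j k)"
    by metis
  have "g (j i) < g (j k)" if "i < k" for i k
    using enumerate_mono[OF that inf] unfolding j .
  then have "strict_mono j" by (simp add: strict_mono_def strict_mono_less[OF assms])
  then have "g n \<le> g (j n)"
    using assms by (simp add: strict_mono_imp_increasing strict_mono_less_eq)
  moreover have "enumerate (range g) n \<le> g n"
    using inf assms by (intro enumerate_le_of_strict_mono_on) (auto simp: strict_mono_def)
  ultimately show "enumerate (range g) n = g n" using j by simp
qed

lemma range_in_inf_subsets:
  fixes g :: "nat \<Rightarrow> nat"
  assumes "strict_mono g" and "g 0 \<ge> 1"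
  shows "range g \<in> inf_subsets"
proof -
  have "g n \<ge> 1" for n
    using assms strict_mono_less_eq[of g 0 n] by linarith
  then show ?thesis
    using range_inj_infinite[OF strict_mono_imp_inj_on[OF assms(1)]]
    unfolding inf_subsets_def by auto
qed

text \<open>After each element of \<open>a\<close>, the next one comes before a value of
  \<open>h\<close> that depends only on the earlier element, so iterating \<open>h\<close> outruns
  every enumeration at once.\<close>

lemma le_bounded_if_meets_intervals:
  fixes h :: "nat \<Rightarrow> nat"
  assumes "B \<subseteq> inf_subsets" and meets: "\<And>a j. a \<in> B \<Longrightarrow> \<exists>n\<in>a. j \<le> n \<and> n < h j"
  shows "le_bounded B"
proof -
  \<comment> \<open>\<open>h\<close> may fail to be monotone. Summing it over all
    \<open>j \<le> v + 1\<close> gives a monotone majorant, so an upper bound \<open>v\<close> for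
    the previous element suffices.\<close>
  define g where "g = rec_nat (h 0 + 1) (\<lambda>_ v. v + 1 + (\<Sum>j\<le>v+1. h j))"
  have g0: "g 0 = h 0 + 1" and gS: "g (Suc n) = g n + 1 + (\<Sum>j\<le>g n + 1. h j)" for n
    by (simp_all add: g_def)
  have mono: "strict_mono g" by (simp add: strict_mono_Suc_iff gS)
  have "enumerate a n \<le> g n" if a: "a \<in> B" for a n
  proof (induction n)
    case 0
    then show ?case
      using meets[OF a, of 0] by (auto simp: enumerate_0 g0 intro: Least_le order.trans)
  next
    case (Suc n)
    obtain k where k: "k \<in> a" "enumerate a n + 1 \<le> k" "k < h (enumerate a n + 1)"
      using meets[OF a] by blast
    have "infinite a" using a assms by (auto simp: inf_subsets_def)
    then have "enumerate a (Suc n) \<le> k"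
      using k by (auto simp: enumerate_Suc'' intro: Least_le)
    also have "h (enumerate a n + 1) \<le> (\<Sum>j\<le>g n + 1. h j)"
      using Suc by (intro member_le_sum) auto
    then have "k \<le> g (Suc n)" using k(3) by (simp add: gS)
    finally show ?case .
  qed
  then have "\<forall>a\<in>B. enum_le a (range g)"
    by (simp add: enum_le_def enumerate_range_strict_mono[OF mono])
  with range_in_inf_subsets[OF mono] show ?thesis
    unfolding le_bounded_def by (auto simp: g0)
qed


section \<open>The dominating number\<close>

lemma dominating_inf_subsets: "dominating inf_subsets"
  unfolding dominating_def enum_le_star_def by force

lemma obtain_dominating_of_minimal_card:
  obtains D where "dominating D" "dominating_number = |D|"
    "\<And>E. dominating E \<Longrightarrow> |D| \<le>o |E|"
proof -
  have "{D. dominating D} \<noteq> {}" using dominating_inf_subsets by blast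
  from min_card[OF this] show ?thesis
    using that unfolding dominating_number_def by auto
qed

lemma infinite_if_dominating:
  assumes "dominating D"
  shows "infinite D"
proof
  assume fin: "finite D"
  \<comment> \<open>The sum majorizes each of the finitely many enumerations, and the summand
    \<open>n + 1\<close> makes the inequality strict, \<open>g\<close> strictly increasing and
    \<open>g 0\<close> positive.\<close>
  define g where "g n = (\<Sum>d\<in>D. enumerate d n) + n + 1" for n
  have inf: "infinite d" if "d \<in> D" for d
    using assms that by (auto simp: dominating_def inf_subsets_def)
  have mono: "strict_mono g"
    unfolding strict_mono_Suc_iff g_def
    by (auto intro!: sum_mono simp: inf less_Suc_eq_le)
  obtain d where d: "d \<in> D" "enum_le_star (range g) d"
    using assms range_in_inf_subsets[OF mono] by (auto simp: dominating_def g_def)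
  have "\<not> g n \<le> enumerate d n" for n
    using member_le_sum[of d D "\<lambda>d. enumerate d n"] d(1) fin by (simp add: g_def)
  then show False
    using d(2) by (simp add: enum_le_star_def enumerate_range_strict_mono[OF mono])
qed

text \<open>An infinite cardinal order has no greatest element, so the whole of \<open>D\<close> is
  strictly cofinal and the minimum ranges over a nonempty family.\<close>

lemma cofinality_attained:
  assumes "infinite D"
  obtains C where "C \<subseteq> D" "cofinal C |D|" "cofinality |D| = |C|"
    "\<And>C'. C' \<subseteq> D \<Longrightarrow> cofinal C' |D| \<Longrightarrow> |C| \<le>o |C'|"
proof -
  have "cofinal D |D|"
    using infinite_Card_order_limit[OF card_of_Card_order[of D]] assms
    by (auto simp: cofinal_def Field_card_of)
  then have "{A. A \<subseteq> Field |D| \<and> cofinal A |D|} \<noteq> {}" by (auto simp: Field_card_of)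
  from min_card[OF this] show ?thesis
    using that unfolding cofinality_def by (auto simp: Field_card_of)
qed

lemma card_of_vimage_less:
  assumes "inj_on x D" and "|x ` D \<inter> B| <o r"
  shows "|{d \<in> D. x d \<in> B}| <o r"
proof -
  have "|{d \<in> D. x d \<in> B}| \<le>o |x ` D \<inter> B|"
    using assms(1) by (intro card_of_ordLeqI[of x]) (auto simp: inj_on_def)
  then show ?thesis using assms(2) ordLeq_ordLess_trans by blast
qed

text \<open>In the cofinality case \<open>x\<close> need not be injective. Fewer than \<kappa>
  points of \<open>C\<close> are not cofinal, so all \<open>d\<close> sent to them lie below a
  single \<gamma>, and proper initial segments of a cardinal order are smaller than the
  whole.\<close>

lemma unbounded_card_indexing:
  assumes "infinite D" and "\<kappa> \<in> {cofinality |D|, |D|}" and A: "unbounded_card \<kappa> A"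
  obtains x where "x ` D \<subseteq> A"
    "\<And>B. B \<subseteq> A \<Longrightarrow> le_bounded B \<Longrightarrow> |{d \<in> D. x d \<in> B}| <o |D|"
proof (cases "\<kappa> = |D|")
  case True
  then obtain x where x: "inj_on x D" "x ` D \<subseteq> A"
    using A by (auto simp: unbounded_card_def card_of_ordLeq[symmetric])
  have "|{d \<in> D. x d \<in> B}| <o |D|" if "B \<subseteq> A" "le_bounded B" for B
  proof (rule card_of_vimage_less[OF x(1)])
    have "|B| <o |D|" using A that True by (simp add: unbounded_card_def)
    then show "|x ` D \<inter> B| <o |D|"
      using card_of_mono1[of "x ` D \<inter> B" B] ordLeq_ordLess_trans by blast
  qed
  with x show ?thesis using that by blast
next
  case False
  obtain C where C: "C \<subseteq> D" "cofinal C |D|" "cofinality |D| = |C|"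
    "\<And>C'. C' \<subseteq> D \<Longrightarrow> cofinal C' |D| \<Longrightarrow> |C| \<le>o |C'|"
    using cofinality_attained[OF assms(1)] by metis
  have \<kappa>: "\<kappa> = |C|" using False assms(2) C(3) by simp
  then obtain i where i: "inj_on i C" "i ` C \<subseteq> A"
    using A by (auto simp: unbounded_card_def card_of_ordLeq[symmetric])
  have "\<forall>d\<in>D. \<exists>e\<in>C. d \<noteq> e \<and> (d, e) \<in> |D|"
    using C(2) by (simp add: cofinal_def Field_card_of)
  then obtain c where c: "\<And>d. d \<in> D \<Longrightarrow> c d \<in> C \<and> d \<noteq> c d \<and> (d, c d) \<in> |D|"
    by metis
  have "|{d \<in> D. i (c d) \<in> B}| <o |D|" if B: "B \<subseteq> A" "le_bounded B" for B
  proof -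
    have "|B| <o |C|" using A B \<kappa> by (simp add: unbounded_card_def)
    then have "|i ` C \<inter> B| <o |C|"
      using card_of_mono1[of "i ` C \<inter> B" B] ordLeq_ordLess_trans by blast
    then have "|{e \<in> C. i e \<in> B}| <o |C|" by (rule card_of_vimage_less[OF i(1)])
    then have "\<not> |C| \<le>o |{e \<in> C. i e \<in> B}|"
      using not_ordLess_ordLeq by blast
    then have "\<not> cofinal {e \<in> C. i e \<in> B} |D|"
      using C(1) C(4)[of "{e \<in> C. i e \<in> B}"] by auto
    then obtain \<gamma> where \<gamma>: "\<gamma> \<in> D"
      "\<And>e. e \<in> C \<Longrightarrow> i e \<in> B \<Longrightarrow> \<gamma> = e \<or> (\<gamma>, e) \<notin> |D|"
      by (auto simp: cofinal_def Field_card_of)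
    \<comment> \<open>By totality \<open>c d\<close> is at most \<gamma>, and \<open>d\<close> lies
      strictly below \<open>c d\<close>.\<close>
    have "d \<in> underS |D| \<gamma>" if d: "d \<in> D" "i (c d) \<in> B" for d
    proof -
      have cd: "c d \<in> D" "d \<noteq> c d" "(d, c d) \<in> |D|" "\<gamma> = c d \<or> (\<gamma>, c d) \<notin> |D|"
        using c[OF d(1)] C(1) \<gamma>(2) d(2) by auto
      have lin: "Total |D|" "trans |D|" "antisym |D|" "Refl |D|"
        using card_of_Well_order[of D] by (auto simp: order_on_defs)
      have "(\<gamma>, c d) \<in> |D| \<or> (c d, \<gamma>) \<in> |D|"
        using lin(1,4) cd(1) \<gamma>(1) unfolding total_on_def refl_on_def Field_card_of by metis
      then have "(c d, \<gamma>) \<in> |D|" using cd(4) by auto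
      then have "(d, \<gamma>) \<in> |D|" "d \<noteq> \<gamma>"
        using cd(2,3) lin(2,3) by (auto dest: transD antisymD)
      then show ?thesis by (simp add: underS_def)
    qed
    then have "|{d \<in> D. i (c d) \<in> B}| \<le>o |underS |D| \<gamma>|"
      by (intro card_of_mono1) blast
    moreover have "|underS |D| \<gamma>| <o |D|"
      using \<gamma>(1) by (intro card_of_underS card_of_Card_order) (simp add: Field_card_of)
    ultimately show ?thesis using ordLeq_ordLess_trans by blast
  qed
  moreover have "(\<lambda>d. i (c d)) ` D \<subseteq> A" using c i(2) by blast
  ultimately show ?thesis using that[of "\<lambda>d. i (c d)"] by blast
qed


section \<open>Sets of natural numbers as real numbers\<close>

text \<open>The image of all sets is the ternary Cantor set scaled by 3/2. In base 3 the terms after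
  position \<open>n\<close> add up to only half of the term at \<open>n\<close>, which separates
  distinct sets.\<close>

definition cantor_real :: "nat set \<Rightarrow> real" where
  "cantor_real S = (\<Sum>n. indicator S n * (1/3) ^ n)"

lemma summable_cantor_real: "summable (\<lambda>n. indicator S n * (1/3 :: real) ^ n)"
  by (rule summable_comparison_test'[where g = "\<lambda>n. (1/3) ^ n" and N = 0])
     (auto simp: indicator_def summable_geometric)

lemma cantor_real_diff_le:
  assumes "S \<inter> {..<k} = T \<inter> {..<k}"
  shows "\<bar>cantor_real S - cantor_real T\<bar> \<le> (1/3) ^ k * (3/2)"
proof -
  define f where "f n = (indicator S n - indicator T n) * (1/3 :: real) ^ n" for n
  have f: "summable f"
    using summable_diff[OF summable_cantor_real[of S] summable_cantor_real[of T]]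
    unfolding f_def left_diff_distrib .
  have "cantor_real S - cantor_real T = suminf f"
    unfolding cantor_real_def f_def left_diff_distrib
    by (intro suminf_diff summable_cantor_real)
  also have "\<dots> = (\<Sum>n. f (n + k)) + sum f {..<k}" by (rule suminf_split_initial_segment[OF f])
  also have "sum f {..<k} = 0"
    using assms by (intro sum.neutral) (auto simp: f_def indicator_def set_eq_iff)
  finally have eq: "cantor_real S - cantor_real T = (\<Sum>n. f (n + k))" by simp
  have geo: "(\<lambda>n. (1/3 :: real) ^ (n + k)) sums ((1/3) ^ k * (3/2))"
    using sums_mult[OF geometric_sums[of "1/3 :: real"], of "(1/3) ^ k"]
    by (simp add: power_add mult.commute)
  have "norm (\<Sum>n. f (n + k)) \<le> (\<Sum>n. (1/3) ^ (n + k))"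
    by (rule norm_suminf_le) (use geo in \<open>auto simp: f_def indicator_def sums_iff\<close>)
  then show ?thesis using eq geo by (simp add: sums_iff)
qed

text \<open>At the first difference \<open>n \<le> k\<close> one number gains
  \<open>(1/3) ^ n\<close>, and the later digits can cancel at most half of that.\<close>

lemma cantor_real_near_imp_agree:
  assumes "\<bar>cantor_real S - cantor_real T\<bar> < (1/3) ^ k / 2"
  shows "S \<inter> {..k} = T \<inter> {..k}"
proof (rule ccontr)
  assume "S \<inter> {..k} \<noteq> T \<inter> {..k}"
  then have ex: "\<exists>n. n \<le> k \<and> (n \<in> S) \<noteq> (n \<in> T)" by auto
  define n where "n = (LEAST n. n \<le> k \<and> (n \<in> S) \<noteq> (n \<in> T))"
  have n: "n \<le> k" "(n \<in> S) \<noteq> (n \<in> T)" using LeastI_ex[OF ex] by (auto simp: n_def)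
  have below: "i \<in> S \<longleftrightarrow> i \<in> T" if "i < n" for i
    using not_less_Least[of i "\<lambda>n. n \<le> k \<and> (n \<in> S) \<noteq> (n \<in> T)"] that n(1)
    unfolding n_def[symmetric] by auto
  have ins: "cantor_real (insert n R) = cantor_real R + (1/3) ^ n" if "n \<notin> R" for R
  proof -
    have "cantor_real (insert n R) =
        (\<Sum>m. indicator R m * (1/3) ^ m + (if m = n then (1/3) ^ m else 0))"
      unfolding cantor_real_def
      by (intro suminf_cong) (use that in \<open>auto simp: indicator_def\<close>)
    also have "\<dots> = cantor_real R + (1/3) ^ n"
      unfolding cantor_real_def
      by (subst suminf_add[symmetric])
         (use summable_cantor_real sums_single[of n "\<lambda>m. (1/3 :: real) ^ m"] in \<open>auto simp: sums_iff\<close>)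
    finally show ?thesis .
  qed
  have le: "(1/3) ^ n / 2 \<le> cantor_real P - cantor_real Q"
    if "n \<in> P" "n \<notin> Q" "\<And>i. i < n \<Longrightarrow> i \<in> P \<longleftrightarrow> i \<in> Q" for P Q
  proof -
    \<comment> \<open>Inserting \<open>n\<close> into \<open>Q\<close> gives agreement through
      position \<open>n\<close>, so the remaining difference is at most
      \<open>(1/3) ^ Suc n * (3/2) = (1/3) ^ n / 2\<close>.\<close>
    have "P \<inter> {..<Suc n} = insert n Q \<inter> {..<Suc n}"
      using that by (auto simp: less_Suc_eq)
    from cantor_real_diff_le[OF this] ins[OF that(2)] show ?thesis unfolding power_Suc by linarith
  qed
  have "(1/3) ^ n / 2 \<le> \<bar>cantor_real S - cantor_real T\<bar>"
  proof (cases "n \<in> S")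
    case True
    then show ?thesis using le[of S T, OF _ _ below] n(2) by linarith
  next
    case False
    then show ?thesis using le[of T S, OF _ _ below[symmetric]] n(2) by linarith
  qed
  moreover have "(1/3 :: real) ^ k \<le> (1/3) ^ n" using n(1) by (intro power_decreasing) auto
  ultimately show False using assms by linarith
qed

lemma cantor_real_eq_iff: "cantor_real S = cantor_real T \<longleftrightarrow> S = T"
proof
  assume "cantor_real S = cantor_real T"
  then have "S \<inter> {..k} = T \<inter> {..k}" for k by (intro cantor_real_near_imp_agree) simp
  then show "S = T" by (metis IntD1 IntI atMost_iff order_refl subsetI subset_antisym)
qed simp

lemma openin_cantor_real_imageE:
  assumes "openin (top_of_set (cantor_real ` Z)) U" and "cantor_real F \<in> U"
  obtains k where "\<And>S. S \<in> Z \<Longrightarrow> S \<inter> {..<k} = F \<inter> {..<k} \<Longrightarrow> cantor_real S \<in> U"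
proof -
  obtain e where e: "e > 0" "\<And>y. y \<in> cantor_real ` Z \<Longrightarrow> dist y (cantor_real F) < e \<Longrightarrow> y \<in> U"
    using assms unfolding openin_euclidean_subtopology_iff by meson
  obtain k where "(1/3 :: real) ^ k < e / 2"
    using real_arch_pow_inv[of "e/2" "1/3"] e(1) by auto
  then have "cantor_real S \<in> U" if "S \<in> Z" "S \<inter> {..<k} = F \<inter> {..<k}" for S
    using cantor_real_diff_le[OF that(2)] that(1) e by (auto simp: dist_real_def)
  then show ?thesis using that by blast
qed

lemma openin_cantor_cylinder:
  assumes "X \<subseteq> Pow {1..}" and "b \<subseteq> {1..}"
  shows "openin (subtopology cantor_topology X) {a \<in> X. a \<inter> {..m} = b \<inter> {..m}}"
proof -
  define V where "V i = (if i \<le> m then {i \<in> b} else UNIV)" for i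
  have "finite {i. V i \<noteq> topspace (discrete_topology (UNIV :: bool set))}"
    by (rule finite_subset[of _ "{..m}"]) (auto simp: V_def)
  then have "openin (product_topology (\<lambda>_. discrete_topology (UNIV :: bool set)) {1..})
      (\<Pi>\<^sub>E i\<in>{1..}. V i)"
    by (intro product_topology_basis) simp
  then have "openin cantor_topology ((\<lambda>a. \<lambda>n\<in>{1..}. n \<in> a) -` (\<Pi>\<^sub>E i\<in>{1..}. V i) \<inter> Pow {1..})"
    unfolding cantor_topology_def openin_pullback_topology by blast
  moreover have "(\<lambda>a. \<lambda>n\<in>{1..}. n \<in> a) -` (\<Pi>\<^sub>E i\<in>{1..}. V i) \<inter> Pow {1..} =
      {a \<in> Pow {1..}. a \<inter> {..m} = b \<inter> {..m}}" (is "?L = ?R")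
  proof (rule set_eqI)
    fix a
    have "a \<in> ?L \<longleftrightarrow> a \<subseteq> {1..} \<and> (\<forall>i\<ge>1. i \<le> m \<longrightarrow> (i \<in> a \<longleftrightarrow> i \<in> b))"
      by (auto simp: PiE_iff V_def)
    also have "\<dots> \<longleftrightarrow> a \<in> ?R" using assms(2) by (auto simp: set_eq_iff)
    finally show "a \<in> ?L \<longleftrightarrow> a \<in> ?R" .
  qed
  moreover have "{a \<in> X. a \<inter> {..m} = b \<inter> {..m}} = {a \<in> Pow {1..}. a \<inter> {..m} = b \<inter> {..m}} \<inter> X"
    using assms(1) by blast
  ultimately show ?thesis by (subst openin_subtopology) auto
qed


section \<open>Coding pairs of sets\<close>

definition interleave :: "nat set \<Rightarrow> nat set \<Rightarrow> nat set" where
  "interleave a b = (\<lambda>n. 2 * n) ` a \<union> (\<lambda>n. 2 * n + 1) ` b"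

text \<open>This is \<open>(x \<triangle> u) \<union> v\<close>, where \<open>u\<close> and
  \<open>v\<close> are the sets coded by the even and odd positions of \<open>z\<close>.\<close>

definition combine :: "nat set \<Rightarrow> nat set \<Rightarrow> nat set" where
  "combine x z = {n. (n \<in> x) \<noteq> (2 * n \<in> z) \<or> 2 * n + 1 \<in> z}"

lemma even_in_interleave [simp]: "2 * n \<in> interleave a b \<longleftrightarrow> n \<in> a"
  unfolding interleave_def by (auto simp: image_iff) presburger+

lemma odd_in_interleave [simp]: "Suc (2 * n) \<in> interleave a b \<longleftrightarrow> n \<in> b"
  unfolding interleave_def by (auto simp: image_iff) presburger+

lemma combine_interleave_self [simp]: "combine x (interleave x b) = b"
  by (simp add: combine_def)

lemma infinite_combine:
  assumes "infinite x" and "finite z \<or> infinite {n. 2 * n + 1 \<in> z}"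
  shows "infinite (combine x z)"
proof (cases "finite z")
  case True
  have "inj (\<lambda>n::nat. 2 * n)" by (simp add: inj_def)
  then have "finite {n. 2 * n \<in> z}"
    using finite_vimageI[OF True] by (simp add: vimage_def)
  then have "infinite (x - {n. 2 * n \<in> z})" using assms(1) by simp
  then show ?thesis by (rule infinite_super[rotated]) (auto simp: combine_def)
next
  case False
  with assms(2) show ?thesis by (auto simp: combine_def intro: infinite_super[rotated])
qed

lemma combine_Int_atMost_cong:
  assumes "x \<inter> {..m} = x' \<inter> {..m}" and "z \<inter> {..2*m+1} = z' \<inter> {..2*m+1}"
  shows "combine x z \<inter> {..m} = combine x' z' \<inter> {..m}"
proof -
  have "n \<in> x \<longleftrightarrow> n \<in> x'" "2 * n \<in> z \<longleftrightarrow> 2 * n \<in> z'" "2 * n + 1 \<in> z \<longleftrightarrow> 2 * n + 1 \<in> z'"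
    if "n \<le> m" for n
    using assms that unfolding set_eq_iff by auto
  then show ?thesis by (auto simp: combine_def)
qed

text \<open>The first \<open>n + 1\<close> elements of \<open>S\<close> are at most \<open>m\<close>
  and hence belong to \<open>T\<close>.\<close>

lemma enumerate_le_transfer:
  fixes S T :: "nat set"
  assumes "infinite S" "infinite T" "S \<inter> {..m} = T \<inter> {..m}" "enumerate S n \<le> m"
  shows "enumerate T n \<le> m"
proof -
  have "enumerate T n \<le> enumerate S n"
  proof (rule enumerate_le_of_strict_mono_on[OF assms(2)])
    fix i assume "i \<le> n"
    then have "enumerate S i \<le> m"
      using assms(1,4) enumerate_mono_le_iff[of S i n] by linarith
    then show "enumerate S i \<in> T"
      using assms(3) enumerate_in_set[OF assms(1), of i] by blast
  qed (use assms(1) in auto)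
  then show ?thesis using assms(4) by simp
qed


section \<open>Concentration and failure of the Menger property\<close>

lemma concentrated_cantor_real_image:
  assumes A: "A \<subseteq> inf_subsets" "x ` D \<subseteq> A"
    and small: "\<And>B. B \<subseteq> A \<Longrightarrow> le_bounded B \<Longrightarrow> |{d \<in> D. x d \<in> B}| <o |D|"
    and sub: "\<And>d. d \<in> D \<Longrightarrow> e d \<subseteq> x d"
    and card: "|D| \<le>o |e ` D|"
  defines "w \<equiv> \<lambda>d. interleave (x d) (e d)"
  defines "Z \<equiv> Collect finite \<union> w ` D"
  shows "concentrated |D| (top_of_set (cantor_real ` Z))"
proof -
  let ?Q = "cantor_real ` Collect finite"
  \<comment> \<open>The odd half of a code recovers \<open>e d\<close>, so there are at least as
    many codes as sets \<open>e d\<close>.\<close>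
  have "e ` D = (\<lambda>z. {n. 2 * n + 1 \<in> z}) ` w ` D" by (auto simp: w_def image_image)
  then have "|e ` D| \<le>o |w ` D|" by (simp add: card_of_image)
  also have "|w ` D| \<le>o |cantor_real ` Z|"
    by (rule card_of_ordLeqI[of cantor_real]) (auto simp: inj_on_def cantor_real_eq_iff Z_def)
  finally have "|D| \<le>o |cantor_real ` Z|" using card ordLeq_transitive by blast
  moreover have "countable ?Q" by (simp add: countable_Collect_finite)
  moreover have "?Q \<subseteq> cantor_real ` Z" by (auto simp: Z_def)
  moreover have "|cantor_real ` Z - U| <o |D|"
    if U: "openin (top_of_set (cantor_real ` Z)) U" "?Q \<subseteq> U" for U
  proof -
    \<comment> \<open>Each of the finitely many \<open>F \<subseteq> {..<m}\<close> has a cylinder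
      of some length \<open>k F\<close> mapped into \<open>U\<close>; the sum of these lengths
      serves them all.\<close>
    have "\<exists>k. \<forall>z\<in>Z. z \<inter> {m..<k} = {} \<longrightarrow> cantor_real z \<in> U" for m
    proof -
      have "\<exists>k. \<forall>z\<in>Z. z \<inter> {..<k} = F \<inter> {..<k} \<longrightarrow> cantor_real z \<in> U" if "F \<subseteq> {..<m}" for F
        using openin_cantor_real_imageE[OF U(1), of F] U(2) that finite_subset
        by (metis finite_lessThan image_subset_iff mem_Collect_eq)
      then obtain k where k: "\<And>F z. F \<subseteq> {..<m} \<Longrightarrow> z \<in> Z \<Longrightarrow> z \<inter> {..<k F} = F \<inter> {..<k F}
          \<Longrightarrow> cantor_real z \<in> U"
        by metis
      have "cantor_real z \<in> U" if z: "z \<in> Z" "z \<inter> {m..<(\<Sum>F\<in>Pow {..<m}. k F)} = {}" for z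
      proof (rule k[OF _ z(1)])
        show "z \<inter> {..<m} \<subseteq> {..<m}" by blast
        have "k (z \<inter> {..<m}) \<le> (\<Sum>F\<in>Pow {..<m}. k F)" by (intro member_le_sum) auto
        then show "z \<inter> {..<k (z \<inter> {..<m})} = z \<inter> {..<m} \<inter> {..<k (z \<inter> {..<m})}"
          using z(2) by (fastforce simp: set_eq_iff)
      qed
      then show ?thesis by blast
    qed
    then obtain h where h: "\<And>m z. z \<in> Z \<Longrightarrow> z \<inter> {m..<h m} = {} \<Longrightarrow> cantor_real z \<in> U"
      by metis
    define B where "B = {x d | d. d \<in> D \<and> cantor_real (w d) \<notin> U}"
    \<comment> \<open>A code outside \<open>U\<close> meets every interval from \<open>m\<close> to
      \<open>h m\<close>. Since \<open>e d \<subseteq> x d\<close>, an element \<open>2 * n\<close>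
      or \<open>2 * n + 1\<close> of the code puts \<open>n\<close> in \<open>x d\<close>; starting
      at \<open>2 * j + 1\<close> ensures \<open>j \<le> n\<close>.\<close>
    have "\<exists>n\<in>a. j \<le> n \<and> n < h (2 * j + 1)" if a: "a \<in> B" for a j
    proof -
      obtain d where d: "d \<in> D" "cantor_real (w d) \<notin> U" "a = x d"
        using a unfolding B_def by blast
      then have "w d \<inter> {2*j+1..<h (2*j+1)} \<noteq> {}" using h[of "w d"] by (auto simp: Z_def)
      then obtain v where "v \<in> w d" "2 * j + 1 \<le> v" "v < h (2 * j + 1)" by auto
      moreover then obtain n where "n \<in> a" "v = 2 * n \<or> v = 2 * n + 1"
        using sub[OF d(1)] d(3) by (auto simp: w_def interleave_def)
      ultimately show ?thesis by (intro bexI[of _ n]) auto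
    qed
    moreover have "B \<subseteq> A" using A(2) by (auto simp: B_def)
    ultimately have "le_bounded B" using A(1) by (intro le_bounded_if_meets_intervals) auto
    then have "|{d \<in> D. x d \<in> B}| <o |D|" using small \<open>B \<subseteq> A\<close> by blast
    moreover have "cantor_real ` Z - U \<subseteq> (cantor_real \<circ> w) ` {d \<in> D. x d \<in> B}"
      using U(2) by (auto simp: Z_def B_def)
    then have "|cantor_real ` Z - U| \<le>o |{d \<in> D. x d \<in> B}|"
      using card_of_image card_of_mono1 ordLeq_transitive by blast
    ultimately show ?thesis using ordLeq_ordLess_trans by blast
  qed
  ultimately show ?thesis
    unfolding concentrated_def by (auto intro!: exI[of _ ?Q])
qed

text \<open>Whether the condition holds depends only on \<open>x\<close> up to \<open>m\<close> and
  on \<open>z\<close> up to \<open>2 * m + 1\<close>, and the radius \<open>?r\<close> fixes exactly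
  these positions of \<open>z\<close>.\<close>

lemma openin_combine_le:
  assumes "X \<subseteq> inf_subsets" and Z: "\<And>z. z \<in> Z \<Longrightarrow> finite z \<or> infinite {n. 2 * n + 1 \<in> z}"
  shows "openin (prod_topology (subtopology cantor_topology X) (top_of_set (cantor_real ` Z)))
    {(x, cantor_real z) | x z. x \<in> X \<and> z \<in> Z \<and> enumerate (combine x z) n \<le> m}"
    (is "openin _ ?W")
  unfolding openin_prod_topology_alt
proof (intro allI impI)
  fix x y
  assume "(x, y) \<in> ?W"
  then obtain z where z: "x \<in> X" "z \<in> Z" "y = cantor_real z" "enumerate (combine x z) n \<le> m"
    by auto
  let ?r = "(1/3 :: real) ^ (2*m+1) / 2"
  let ?U = "{a \<in> X. a \<inter> {..m} = x \<inter> {..m}}" and ?V = "cantor_real ` Z \<inter> ball y ?r"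
  have "openin (subtopology cantor_topology X) ?U"
    using assms(1) z(1) by (intro openin_cantor_cylinder) (auto simp: inf_subsets_def)
  moreover have "openin (top_of_set (cantor_real ` Z)) ?V" by (simp add: openin_open_Int)
  moreover have "x \<in> ?U" "y \<in> ?V" using z by auto
  moreover have "?U \<times> ?V \<subseteq> ?W"
  proof (intro subrelI)
    fix x' y' assume "(x', y') \<in> ?U \<times> ?V"
    then obtain z' where z': "x' \<in> X" "x \<inter> {..m} = x' \<inter> {..m}" "z' \<in> Z" "y' = cantor_real z'"
      "\<bar>cantor_real z - cantor_real z'\<bar> < ?r"
      using z(3) by (auto simp: dist_real_def)
    have "combine x z \<inter> {..m} = combine x' z' \<inter> {..m}"
      by (rule combine_Int_atMost_cong[OF z'(2) cantor_real_near_imp_agree[OF z'(5)]])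
    moreover have "infinite (combine x z)" "infinite (combine x' z')"
      using assms(1) z(1) z'(1) infinite_combine[OF _ Z[OF z(2)]] infinite_combine[OF _ Z[OF z'(3)]]
      by (auto simp: inf_subsets_def)
    ultimately have "enumerate (combine x' z') n \<le> m"
      using z(4) enumerate_le_transfer by blast
    then show "(x', y') \<in> ?W" using z' by blast
  qed
  ultimately show "\<exists>U V. openin (subtopology cantor_topology X) U \<and>
      openin (top_of_set (cantor_real ` Z)) V \<and> x \<in> U \<and> y \<in> V \<and> U \<times> V \<subseteq> ?W"
    by blast
qed

text \<open>Finite selections from the covers \<open>W n\<close> would bound the \<open>n\<close>-th
  elements for some \<open>n\<close> at each point; a function above all these bounds then escapes
  domination.\<close>

lemma not_menger_if_combine_dominating:
  assumes X: "X \<subseteq> inf_subsets" and Z: "\<And>z. z \<in> Z \<Longrightarrow> finite z \<or> infinite {n. 2 * n + 1 \<in> z}"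
    and dom: "\<And>a. a \<in> inf_subsets \<Longrightarrow> \<exists>x\<in>X. \<exists>z\<in>Z. enum_le_star a (combine x z)"
  shows "\<not> menger_space (prod_topology (subtopology cantor_topology X) (top_of_set (cantor_real ` Z)))"
    (is "\<not> menger_space ?T")
proof
  assume menger: "menger_space ?T"
  have top: "topspace ?T = X \<times> cantor_real ` Z"
  proof -
    have "topspace cantor_topology = Pow {1..}"
      by (auto simp: cantor_topology_def topspace_pullback_topology)
    then show ?thesis using X by (auto simp: inf_subsets_def)
  qed
  define W where "W n m = {(x, cantor_real z) | x z. x \<in> X \<and> z \<in> Z \<and> enumerate (combine x z) n \<le> m}"
    for n m
  have cover: "open_cover ?T (range (W n))" for n
  proof -
    have "\<Union>(range (W n)) = X \<times> cantor_real ` Z" unfolding W_def by blast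
    moreover have "openin ?T (W n m)" for m
      unfolding W_def by (rule openin_combine_le[OF X Z])
    ultimately show ?thesis unfolding open_cover_def top by blast
  qed
  have W_mono: "W n m \<subseteq> W n m'" if "m \<le> m'" for n m m'
    using that unfolding W_def by fastforce
  text \<open>The cover property is applied to every tail of the sequence of covers, so that the
    resulting bound is exceeded beyond every index.\<close>
  have "\<exists>b. \<forall>p\<in>X \<times> cantor_real ` Z. \<exists>n. p \<in> W (N + n) (b n)" for N
  proof -
    have "\<exists>\<F>. (\<forall>n. finite (\<F> n) \<and> \<F> n \<subseteq> range (W (N + n))) \<and>
        \<Union>(\<Union>n. \<F> n) = X \<times> cantor_real ` Z"
      using menger[unfolded menger_space_def, THEN spec, of "\<lambda>n. range (W (N + n))"]
        cover unfolding top by simp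
    then obtain \<F> where \<F>: "\<forall>n. finite (\<F> n) \<and> \<F> n \<subseteq> range (W (N + n))"
      "\<Union>(\<Union>n. \<F> n) = X \<times> cantor_real ` Z"
      by (elim exE conjE)
    have "\<exists>b. \<forall>S\<in>\<F> n. S \<subseteq> W (N + n) b" for n
    proof -
      obtain I where "finite I" "\<F> n = W (N + n) ` I"
        using \<F>(1) finite_subset_image by metis
      then show ?thesis
        \<comment> \<open>\<open>\<Sum>I\<close> is an upper bound of the finite set
          \<open>I\<close>, and \<open>W\<close> increases in its second argument.\<close>
        by (intro exI[of _ "\<Sum>I"]) (auto intro: W_mono[THEN subsetD] member_le_sum[of _ I id, simplified])
    qed
    then obtain b where "\<And>n S. S \<in> \<F> n \<Longrightarrow> S \<subseteq> W (N + n) (b n)" by metis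
    with \<F>(2) show ?thesis by (intro exI[of _ b]) blast
  qed
  then obtain b where b: "\<And>N p. p \<in> X \<times> cantor_real ` Z \<Longrightarrow> \<exists>n. p \<in> W (N + n) (b N n)"
    by metis
  \<comment> \<open>Position \<open>k\<close> must exceed \<open>b N n\<close> for every splitting
    \<open>k = N + n\<close>. The outer sum makes \<open>g\<close> increasing, and
    \<open>k + 1\<close> makes it strictly so and the bound strict.\<close>
  define g where "g k = (\<Sum>j\<le>k. \<Sum>N\<le>j. b N (j - N)) + k + 1" for k
  have mono: "strict_mono g" by (simp add: strict_mono_Suc_iff g_def)
  have b_less: "b N n < g (N + n)" for N n
  proof -
    have "b N n \<le> (\<Sum>M\<le>N+n. b M (N + n - M))"
      using member_le_sum[of N "{..N+n}" "\<lambda>M. b M (N + n - M)"] by simp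
    also have "\<dots> \<le> (\<Sum>j\<le>N+n. \<Sum>M\<le>j. b M (j - M))" by (rule member_le_sum) auto
    finally show ?thesis by (simp add: g_def)
  qed
  obtain x z where xz: "x \<in> X" "z \<in> Z" "enum_le_star (range g) (combine x z)"
    using dom[OF range_in_inf_subsets[OF mono]] by (auto simp: g_def)
  then obtain N where N: "\<And>k. N \<le> k \<Longrightarrow> g k \<le> enumerate (combine x z) k"
    unfolding enum_le_star_def enumerate_range_strict_mono[OF mono] finite_nat_set_iff_bounded
    by (metis mem_Collect_eq not_less)
  \<comment> \<open>The selection for the tail starting at \<open>N\<close> gives a failure at an
    index \<open>N + n\<close>, where domination already holds.\<close>
  obtain n where "enumerate (combine x z) (N + n) \<le> b N n"
    using b[of "(x, cantor_real z)" N] xz(1,2) by (auto simp: W_def cantor_real_eq_iff)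
  then show False using N[of "N + n"] b_less[of N n] by simp
qed

theorem theorem2p7:
  fixes \<kappa> :: "nat set rel" and X :: "nat set set"
  assumes "\<kappa> \<in> {cofinality dominating_number, dominating_number}"
    and "X \<subseteq> inf_subsets"
    and "\<exists>A\<subseteq>X. unbounded_card \<kappa> A"
  shows "\<exists>Y :: real set. concentrated dominating_number (top_of_set Y) \<and>
    \<not> menger_space (prod_topology (subtopology cantor_topology X) (top_of_set Y))"
proof -
  obtain D where D: "dominating D" "dominating_number = |D|"
    and D_min: "\<And>E. dominating E \<Longrightarrow> |D| \<le>o |E|"
    using obtain_dominating_of_minimal_card by blast
  obtain A where A: "A \<subseteq> X" "unbounded_card \<kappa> A" using assms(3) by blast
  obtain x where x: "x ` D \<subseteq> A"
    and small: "\<And>B. B \<subseteq> A \<Longrightarrow> le_bounded B \<Longrightarrow> |{d \<in> D. x d \<in> B}| <o |D|"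
    using unbounded_card_indexing[OF infinite_if_dominating[OF D(1)] assms(1)[unfolded D(2)] A(2)]
    by blast
  \<comment> \<open>The elements of \<open>x d\<close> at the positions listed by \<open>d\<close>.
    The \<open>k\<close>-th element of \<open>x d\<close> is at least \<open>k\<close>, so
    \<open>e d\<close> lies above \<open>d\<close>.\<close>
  define e where "e d = range (\<lambda>n. enumerate (x d) (enumerate d n))" for d
  have inf: "infinite d" "infinite (x d)" "x d \<subseteq> {1..}" "x d \<in> X" if "d \<in> D" for d
    using that D(1) x A(1) assms(2) by (auto simp: dominating_def inf_subsets_def)
  have sub: "e d \<subseteq> x d" if "d \<in> D" for d
    using inf(2)[OF that] enumerate_in_set by (auto simp: e_def)
  have mono: "strict_mono (\<lambda>n. enumerate (x d) (enumerate d n))" if "d \<in> D" for d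
    using inf[OF that] by (auto simp: strict_mono_def)
  have e_inf: "e d \<in> inf_subsets" if "d \<in> D" for d
    using range_inj_infinite[OF strict_mono_imp_inj_on[OF mono[OF that]]] sub[OF that] inf(3)[OF that]
    by (auto simp: inf_subsets_def e_def)
  have d_le_e: "enumerate d n \<le> enumerate (e d) n" if "d \<in> D" for d n
    using le_enumerate[OF inf(2)[OF that]]
    by (simp add: e_def enumerate_range_strict_mono[OF mono[OF that]])
  have star: "enum_le_star a (e d)" if "d \<in> D" "enum_le_star a d" for a d
    using that(2) d_le_e[OF that(1)] unfolding enum_le_star_def
    by (elim finite_subset[rotated]) (auto intro: order.trans)
  \<comment> \<open>Minimality of \<open>|D|\<close> bounds the number of sets \<open>e d\<close>
    from below, even when \<open>x\<close> is not injective.\<close>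
  have "dominating (e ` D)"
    using D(1) e_inf star unfolding dominating_def by blast
  then have card: "|D| \<le>o |e ` D|" by (rule D_min)
  define Z where "Z = Collect finite \<union> (\<lambda>d. interleave (x d) (e d)) ` D"
  have "concentrated |D| (top_of_set (cantor_real ` Z))"
    unfolding Z_def using A assms(2) x small sub card
    by (intro concentrated_cantor_real_image) auto
  moreover have "\<not> menger_space (prod_topology (subtopology cantor_topology X) (top_of_set (cantor_real ` Z)))"
  proof (rule not_menger_if_combine_dominating[OF assms(2)])
    show "finite z \<or> infinite {n. 2 * n + 1 \<in> z}" if "z \<in> Z" for z
      using that e_inf by (auto simp: Z_def inf_subsets_def)
    fix a assume "a \<in> inf_subsets"
    then obtain d where "d \<in> D" "enum_le_star a d" using D(1) by (auto simp: dominating_def)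
    then show "\<exists>x\<in>X. \<exists>z\<in>Z. enum_le_star a (combine x z)"
      \<comment> \<open>Combining \<open>x d\<close> with its own code cancels the even half and
        leaves \<open>e d\<close>.\<close>
      using star inf(4) by (intro bexI[of _ "x d"] bexI[of _ "interleave (x d) (e d)"]) (auto simp: Z_def)
  qed
  ultimately show ?thesis using D(2) by metis
qed

end
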